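(* Let $F$ be a field of characteristic $0$, let $A$ be a finite-dimensional simple algebra over $F$ with a comultiplication $\Delta:A\to A\otimes A$, and suppose that the Drinfeld double $D(A)$ of $(A,\Delta)$ is a direct sum $D(A)=A_1\oplus A_2$ of two simple ideals $A_1,A_2$. Let $\phi_1,\phi_2:A^*\to A$ be the linear maps determined by $f-\phi_i(f)\in A_i$ for all $f\in A^*$, and let $\psi:A\to A^*$ be the linear isomorphism determined by $a=-\phi_1(\psi(a))+\phi_2(\psi(a))$ for all $a\in A$. Then the operator $R:A\to A$ defined by $$R(a)=\phi_1(\psi(a))\qquad (a\in A)$$ is a Rota-Baxter operator of weight $1$ on $A$.
   Context: Algebras are not assumed associative, commutative or unital. An algebra is simple if its product is not identically zero and it has no two-sided ideals other than $0$ and itself. A comultiplication on a vector space $A$ is a linear map $\Delta:A\to A\otimes A$; write $\Delta(a)=\sum a_{(1)}\otimes a_{(2)}$. The dual space $A^*$ is an algebra with product $(fg)(a)=\sum f(a_{(1)})g(a_{(2)})$. For $a,b\in A$ and $f\in A^*$ put $$f\rightharpoonup a=\sum a_{(1)}f(a_{(2)})\in A,\qquad a\leftharpoonup f=\sum f(a_{(1)})a_{(2)}\in A,$$ and define $f\leftharpoondown a\in A^*$ and $b\rightharpoondown f\in A^*$ by $$(f\leftharpoondown a)(b)=f(ab),\qquad (b\rightharpoondown f)(a)=f(ab).$$ The Drinfeld double of $(A,\Delta)$ is the vector space $D(A)=A\oplus A^*$ with the multiplication $$(a+f)(b+g)=(ab+f\rightharpoonup b+a\leftharpoonup g)+(fg+f\leftharpoondown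 b+a\rightharpoondown g),\quad a,b\in A,\ f,g\in A^*.$$ $A$ and $A^*$ are subalgebras of $D(A)$. It is known that for simple $A$ every proper nonzero ideal of $D(A)$ has dimension $\dim A$; thus $\dim A_1=\dim A_2=\dim A$. For each $f\in A^*$ there is a unique $\phi_i(f)\in A$ with $f-\phi_i(f)\in A_i$ ($i=1,2$), and for each $a\in A$ there is a unique $f\in A^*$ with $a=-\phi_1(f)+\phi_2(f)$; this $f$ is $\psi(a)$. For $\lambda\in F$, a linear operator $R:A\to A$ is a Rota-Baxter operator of weight $\lambda$ if $R(x)R(y)=R(R(x)y+xR(y)+\lambda xy)$ for all $x,y\in A$. *)

theory Defs
  imports Complex_Main
    "HOL-Library.Poly_Mapping"
    "HOL-Library.Function_Algebras"
    "HOL-Library.Product_Plus"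
begin

section \<open>Algebras, ideals, simplicity\<close>

definition bilinear_map ::
  "('f::field \<Rightarrow> 'a::ab_group_add \<Rightarrow> 'a) \<Rightarrow> ('f \<Rightarrow> 'b::ab_group_add \<Rightarrow> 'b) \<Rightarrow>
   ('a \<Rightarrow> 'a \<Rightarrow> 'b) \<Rightarrow> bool" where
  "bilinear_map s t \<beta> \<longleftrightarrow>
     (\<forall>x. Vector_Spaces.linear s t (\<lambda>y. \<beta> x y)) \<and>
     (\<forall>y. Vector_Spaces.linear s t (\<lambda>x. \<beta> x y))"

locale fd_algebra = vector_space scale
  for scale :: "'f::field \<Rightarrow> 'a::ab_group_add \<Rightarrow> 'a" +
  fixes mult :: "'a \<Rightarrow> 'a \<Rightarrow> 'a"
  assumes bilinear_mult: "bilinear_map scale scale mult"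
    and finite_dim: "\<exists>B. finite B \<and> span B = UNIV"

text \<open>In the next three definitions the algebra is the subspace \<open>C\<close> of the ambient
  vector space, so that they apply to \<open>A\<close>, to \<open>D(A)\<close> and to ideals of \<open>D(A)\<close> alike.\<close>

definition is_ideal ::
  "('f::field \<Rightarrow> 'v::ab_group_add \<Rightarrow> 'v) \<Rightarrow> ('v \<Rightarrow> 'v \<Rightarrow> 'v) \<Rightarrow> 'v set \<Rightarrow> 'v set \<Rightarrow> bool" where
  "is_ideal s m C I \<longleftrightarrow>
     module.subspace s I \<and> I \<subseteq> C \<and> (\<forall>x\<in>C. \<forall>y\<in>I. m x y \<in> I \<and> m y x \<in> I)"

definition simple_algebra ::
  "('f::field \<Rightarrow> 'v::ab_group_add \<Rightarrow> 'v) \<Rightarrow> ('v \<Rightarrow> 'v \<Rightarrow> 'v) \<Rightarrow> 'v set \<Rightarrow> bool" where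
  "simple_algebra s m C \<longleftrightarrow>
     (\<exists>x\<in>C. \<exists>y\<in>C. m x y \<noteq> 0) \<and> (\<forall>I. is_ideal s m C I \<longrightarrow> I = {0} \<or> I = C)"

definition is_direct_sum :: "'v::ab_group_add set \<Rightarrow> 'v set \<Rightarrow> 'v set \<Rightarrow> bool" where
  "is_direct_sum C I J \<longleftrightarrow> C = {x + y | x y. x \<in> I \<and> y \<in> J} \<and> I \<inter> J = {0}"


section \<open>The tensor square \<open>A \<otimes> A\<close>\<close>

text \<open>\<open>A \<otimes> A\<close> is the free vector space on \<open>A \<times> A\<close> modulo the span of the usual bilinearity
  relations.  Its elements are cosets, i.e. sets of formal linear combinations of pairs.\<close>

definition free_scale :: "'f::field \<Rightarrow> ('k \<Rightarrow>\<^sub>0 'f) \<Rightarrow> ('k \<Rightarrow>\<^sub>0 'f)" where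
  "free_scale c p = Poly_Mapping.map (\<lambda>x. c * x) p"

abbreviation pure :: "'a \<Rightarrow> 'a \<Rightarrow> ('a \<times> 'a) \<Rightarrow>\<^sub>0 'f::field" where
  "pure x y \<equiv> Poly_Mapping.single (x, y) 1"

definition tensor_relations ::
  "('f::field \<Rightarrow> 'a::ab_group_add \<Rightarrow> 'a) \<Rightarrow> (('a \<times> 'a) \<Rightarrow>\<^sub>0 'f) set" where
  "tensor_relations scale =
     {pure (x + x') y - pure x y - pure x' y | x x' y. True} \<union>
     {pure x (y + y') - pure x y - pure x y' | x y y'. True} \<union>
     {pure (scale c x) y - free_scale c (pure x y) | c x y. True} \<union>
     {pure x (scale c y) - free_scale c (pure x y) | c x y. True}"

definition tensor_null ::
  "('f::field \<Rightarrow> 'a::ab_group_add \<Rightarrow> 'a) \<Rightarrow> (('a \<times> 'a) \<Rightarrow>\<^sub>0 'f) set" where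
  "tensor_null scale = module.span free_scale (tensor_relations scale)"

definition tensor_class ::
  "('f::field \<Rightarrow> 'a::ab_group_add \<Rightarrow> 'a) \<Rightarrow> (('a \<times> 'a) \<Rightarrow>\<^sub>0 'f) \<Rightarrow> (('a \<times> 'a) \<Rightarrow>\<^sub>0 'f) set" where
  "tensor_class scale p = {q. q - p \<in> tensor_null scale}"

definition tensors ::
  "('f::field \<Rightarrow> 'a::ab_group_add \<Rightarrow> 'a) \<Rightarrow> (('a \<times> 'a) \<Rightarrow>\<^sub>0 'f) set set" where
  "tensors scale = range (tensor_class scale)"

definition tensor_add ::
  "('f::field \<Rightarrow> 'a::ab_group_add \<Rightarrow> 'a) \<Rightarrow> (('a \<times> 'a) \<Rightarrow>\<^sub>0 'f) set \<Rightarrow>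
   (('a \<times> 'a) \<Rightarrow>\<^sub>0 'f) set \<Rightarrow> (('a \<times> 'a) \<Rightarrow>\<^sub>0 'f) set" where
  "tensor_add scale S T = (\<Union>p\<in>S. \<Union>q\<in>T. tensor_class scale (p + q))"

definition tensor_scale ::
  "('f::field \<Rightarrow> 'a::ab_group_add \<Rightarrow> 'a) \<Rightarrow> 'f \<Rightarrow> (('a \<times> 'a) \<Rightarrow>\<^sub>0 'f) set \<Rightarrow>
   (('a \<times> 'a) \<Rightarrow>\<^sub>0 'f) set" where
  "tensor_scale scale c T = (\<Union>p\<in>T. tensor_class scale (free_scale c p))"

definition free_lift ::
  "('f::field \<Rightarrow> 'b::ab_group_add \<Rightarrow> 'b) \<Rightarrow> ('a \<Rightarrow> 'a \<Rightarrow> 'b) \<Rightarrow> (('a \<times> 'a) \<Rightarrow>\<^sub>0 'f) \<Rightarrow> 'b" where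
  "free_lift t \<beta> p = (\<Sum>k\<in>Poly_Mapping.keys p. t (Poly_Mapping.lookup p k) (\<beta> (fst k) (snd k)))"

text \<open>The linear map on \<open>A \<otimes> A\<close> induced by a bilinear \<open>\<beta>\<close>; this renders Sweedler sums:
  \<open>tensor_lift t \<beta> (\<Delta> a)\<close> is \<open>\<Sum> \<beta> a\<^sub>(\<^sub>1\<^sub>) a\<^sub>(\<^sub>2\<^sub>)\<close>.  Independence of the representative is
  \<open>tensor_lift_class\<close> below.\<close>

definition tensor_lift ::
  "('f::field \<Rightarrow> 'b::ab_group_add \<Rightarrow> 'b) \<Rightarrow> ('a \<Rightarrow> 'a \<Rightarrow> 'b) \<Rightarrow> (('a \<times> 'a) \<Rightarrow>\<^sub>0 'f) set \<Rightarrow> 'b" where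
  "tensor_lift t \<beta> T = the_elem (free_lift t \<beta> ` T)"

definition comultiplication ::
  "('f::field \<Rightarrow> 'a::ab_group_add \<Rightarrow> 'a) \<Rightarrow> ('a \<Rightarrow> (('a \<times> 'a) \<Rightarrow>\<^sub>0 'f) set) \<Rightarrow> bool" where
  "comultiplication scale \<Delta> \<longleftrightarrow>
     (\<forall>a. \<Delta> a \<in> tensors scale) \<and>
     (\<forall>a b. \<Delta> (a + b) = tensor_add scale (\<Delta> a) (\<Delta> b)) \<and>
     (\<forall>c a. \<Delta> (scale c a) = tensor_scale scale c (\<Delta> a))"


section \<open>The Drinfeld double\<close>

definition dual :: "('f::field \<Rightarrow> 'a::ab_group_add \<Rightarrow> 'a) \<Rightarrow> ('a \<Rightarrow> 'f) set" where
  "dual scale = {f. Vector_Spaces.linear scale (*) f}"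

definition dual_mult ::
  "('a \<Rightarrow> (('a \<times> 'a) \<Rightarrow>\<^sub>0 'f) set) \<Rightarrow> ('a \<Rightarrow> 'f) \<Rightarrow> ('a \<Rightarrow> 'f) \<Rightarrow> ('a \<Rightarrow> 'f::field)" where
  "dual_mult \<Delta> f g = (\<lambda>a. tensor_lift (*) (\<lambda>x y. f x * g y) (\<Delta> a))"

text \<open>\<open>f \<rightharpoonup> a\<close> and \<open>a \<leftharpoonup> f\<close>\<close>

definition hit_left ::
  "('f::field \<Rightarrow> 'a::ab_group_add \<Rightarrow> 'a) \<Rightarrow> ('a \<Rightarrow> (('a \<times> 'a) \<Rightarrow>\<^sub>0 'f) set) \<Rightarrow>
   ('a \<Rightarrow> 'f) \<Rightarrow> 'a \<Rightarrow> 'a" where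
  "hit_left scale \<Delta> f a = tensor_lift scale (\<lambda>x y. scale (f y) x) (\<Delta> a)"

definition hit_right ::
  "('f::field \<Rightarrow> 'a::ab_group_add \<Rightarrow> 'a) \<Rightarrow> ('a \<Rightarrow> (('a \<times> 'a) \<Rightarrow>\<^sub>0 'f) set) \<Rightarrow>
   'a \<Rightarrow> ('a \<Rightarrow> 'f) \<Rightarrow> 'a" where
  "hit_right scale \<Delta> a f = tensor_lift scale (\<lambda>x y. scale (f x) y) (\<Delta> a)"

text \<open>\<open>f \<leftharpoondown> a\<close> and \<open>b \<rightharpoondown> f\<close>\<close>

definition dual_hit_right :: "('a \<Rightarrow> 'a \<Rightarrow> 'a) \<Rightarrow> ('a \<Rightarrow> 'f) \<Rightarrow> 'a \<Rightarrow> ('a \<Rightarrow> 'f)" where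
  "dual_hit_right mult f a = (\<lambda>b. f (mult a b))"

definition dual_hit_left :: "('a \<Rightarrow> 'a \<Rightarrow> 'a) \<Rightarrow> 'a \<Rightarrow> ('a \<Rightarrow> 'f) \<Rightarrow> ('a \<Rightarrow> 'f)" where
  "dual_hit_left mult b f = (\<lambda>a. f (mult a b))"

text \<open>\<open>a + f \<in> D(A)\<close> is the pair \<open>(a, f)\<close>; so \<open>a\<close> is embedded as \<open>(a, 0)\<close> and \<open>f\<close> as \<open>(0, f)\<close>.
  The type \<open>'a \<times> ('a \<Rightarrow> 'f)\<close> also contains pairs with non-linear \<open>f\<close>, hence the carrier.\<close>

definition double_carrier ::
  "('f::field \<Rightarrow> 'a::ab_group_add \<Rightarrow> 'a) \<Rightarrow> ('a \<times> ('a \<Rightarrow> 'f)) set" where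
  "double_carrier scale = UNIV \<times> dual scale"

definition double_scale ::
  "('f::field \<Rightarrow> 'a::ab_group_add \<Rightarrow> 'a) \<Rightarrow> 'f \<Rightarrow> 'a \<times> ('a \<Rightarrow> 'f) \<Rightarrow> 'a \<times> ('a \<Rightarrow> 'f)" where
  "double_scale scale c u = (scale c (fst u), (\<lambda>x. c * snd u x))"

definition double_mult ::
  "('f::field \<Rightarrow> 'a::ab_group_add \<Rightarrow> 'a) \<Rightarrow> ('a \<Rightarrow> 'a \<Rightarrow> 'a) \<Rightarrow> ('a \<Rightarrow> (('a \<times> 'a) \<Rightarrow>\<^sub>0 'f) set) \<Rightarrow>
   'a \<times> ('a \<Rightarrow> 'f) \<Rightarrow> 'a \<times> ('a \<Rightarrow> 'f) \<Rightarrow> 'a \<times> ('a \<Rightarrow> 'f)" where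
  "double_mult scale mult \<Delta> u v =
     (case u of (a, f) \<Rightarrow> case v of (b, g) \<Rightarrow>
       (mult a b + hit_left scale \<Delta> f b + hit_right scale \<Delta> a g,
        dual_mult \<Delta> f g + dual_hit_right mult f b + dual_hit_left mult a g))"


section \<open>The maps \<open>\<phi>\<^sub>i\<close> and \<open>\<psi>\<close>, Rota-Baxter operators\<close>

definition phi :: "('a \<times> ('a \<Rightarrow> 'f)) set \<Rightarrow> ('a \<Rightarrow> 'f::field) \<Rightarrow> 'a::ab_group_add" where
  "phi I f = (THE a. (0, f) - (a, 0) \<in> I)"

definition psi ::
  "('f::field \<Rightarrow> 'a::ab_group_add \<Rightarrow> 'a) \<Rightarrow> ('a \<times> ('a \<Rightarrow> 'f)) set \<Rightarrow> ('a \<times> ('a \<Rightarrow> 'f)) set \<Rightarrow>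
   'a \<Rightarrow> ('a \<Rightarrow> 'f)" where
  "psi scale I J a = (THE f. f \<in> dual scale \<and> a = - phi I f + phi J f)"

definition rota_baxter ::
  "('f::field \<Rightarrow> 'a::ab_group_add \<Rightarrow> 'a) \<Rightarrow> ('a \<Rightarrow> 'a \<Rightarrow> 'a) \<Rightarrow> 'f \<Rightarrow> ('a \<Rightarrow> 'a) \<Rightarrow> bool" where
  "rota_baxter scale mult l R \<longleftrightarrow>
     Vector_Spaces.linear scale scale R \<and>
     (\<forall>x y. mult (R x) (R y) = R (mult (R x) y + mult x (R y) + scale l (mult x y)))"


section \<open>Well-definedness\<close>

lemma lookup_free_scale [simp]:
  "Poly_Mapping.lookup (free_scale c p) k = c * Poly_Mapping.lookup p k"
  by (simp add: free_scale_def Poly_Mapping.map.rep_eq when_def)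

lemma vector_space_free_scale: "vector_space free_scale"
  by unfold_locales (auto intro!: poly_mapping_eqI simp: lookup_add algebra_simps)

lemma vector_space_double_scale:
  assumes "vector_space scale"
  shows "vector_space (double_scale scale)"
proof -
  interpret vector_space scale by fact
  show ?thesis
    by unfold_locales
      (auto simp: double_scale_def prod_eq_iff fun_eq_iff scale_right_distrib scale_left_distrib
        distrib_left distrib_right mult.assoc)
qed

lemma free_lift_superset:
  assumes "vector_space t" "finite K" "Poly_Mapping.keys p \<subseteq> K"
  shows "free_lift t \<beta> p = (\<Sum>k\<in>K. t (Poly_Mapping.lookup p k) (\<beta> (fst k) (snd k)))"
proof -
  interpret t: vector_space t by fact
  show ?thesis unfolding free_lift_def
    by (rule sum.mono_neutral_left) (use assms in \<open>auto simp: in_keys_iff\<close>)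
qed

lemma linear_free_lift:
  fixes t :: "'f::field \<Rightarrow> 'b::ab_group_add \<Rightarrow> 'b" and \<beta> :: "'a \<Rightarrow> 'a \<Rightarrow> 'b"
  assumes t: "vector_space t"
  shows "Vector_Spaces.linear free_scale t (free_lift t \<beta>)"
proof -
  interpret t: vector_space t by fact
  have add: "free_lift t \<beta> (p + q) = free_lift t \<beta> p + free_lift t \<beta> q" for p q
  proof -
    let ?K = "Poly_Mapping.keys p \<union> Poly_Mapping.keys q"
    have "Poly_Mapping.keys (p + q) \<subseteq> ?K" by (rule Poly_Mapping.keys_add)
    then show ?thesis
      by (simp add: free_lift_superset[OF t, of ?K] lookup_add t.scale_left_distrib sum.distrib)
  qed
  have scl: "free_lift t \<beta> (free_scale c p) = t c (free_lift t \<beta> p)" for c p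
  proof -
    have "Poly_Mapping.keys (free_scale c p) \<subseteq> Poly_Mapping.keys p" by (auto simp: in_keys_iff)
    then show ?thesis
      by (simp add: free_lift_superset[OF t, of "Poly_Mapping.keys p"] t.scale_sum_right)
  qed
  show ?thesis
    using vector_space_free_scale t add scl
    by (auto intro!: Vector_Spaces.linear.intro simp: module_hom_def module_hom_axioms_def
        vector_space_def module_def)
qed

lemma free_lift_pure: "vector_space t \<Longrightarrow> free_lift t \<beta> (pure x y) = \<beta> x y"
  by (simp add: free_lift_def vector_space_def)

lemma free_lift_null:
  assumes t: "vector_space t" and \<beta>: "bilinear_map scale t \<beta>" and p: "p \<in> tensor_null scale"
  shows "free_lift t \<beta> p = 0"
proof -
  interpret L: Vector_Spaces.linear free_scale t "free_lift t \<beta>" by (rule linear_free_lift[OF t])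
  have 1: "Vector_Spaces.linear scale t (\<lambda>y. \<beta> x y)" for x using \<beta> by (auto simp: bilinear_map_def)
  have 2: "Vector_Spaces.linear scale t (\<lambda>x. \<beta> x y)" for y using \<beta> by (auto simp: bilinear_map_def)
  have "L.vs1.span (tensor_relations scale) \<subseteq> {p. free_lift t \<beta> p = 0}"
  proof (rule L.vs1.span_minimal)
    show "tensor_relations scale \<subseteq> {p. free_lift t \<beta> p = 0}"
      by (auto simp: tensor_relations_def L.diff L.scale free_lift_pure[OF t]
          module_hom.add[OF Vector_Spaces.linear.axioms(3)[OF 1]]
          module_hom.add[OF Vector_Spaces.linear.axioms(3)[OF 2]]
          module_hom.scale[OF Vector_Spaces.linear.axioms(3)[OF 1]]
          module_hom.scale[OF Vector_Spaces.linear.axioms(3)[OF 2]])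
    show "L.vs1.subspace {p. free_lift t \<beta> p = 0}"
      by (rule L.subspace_kernel)
  qed
  then show ?thesis using p by (auto simp: tensor_null_def)
qed

lemma tensor_class_self:
  fixes scale :: "'f::field \<Rightarrow> 'a::ab_group_add \<Rightarrow> 'a"
  shows "p \<in> tensor_class scale p"
proof -
  interpret vector_space "free_scale :: 'f \<Rightarrow> _ \<Rightarrow> ('a \<times> 'a) \<Rightarrow>\<^sub>0 'f" by (rule vector_space_free_scale)
  show ?thesis by (simp add: tensor_class_def tensor_null_def span_zero)
qed

lemma tensor_class_eqI:
  fixes scale :: "'f::field \<Rightarrow> 'a::ab_group_add \<Rightarrow> 'a"
  assumes "p - q \<in> tensor_null scale"
  shows "tensor_class scale p = tensor_class scale q"
proof -
  interpret vector_space "free_scale :: 'f \<Rightarrow> _ \<Rightarrow> ('a \<times> 'a) \<Rightarrow>\<^sub>0 'f" by (rule vector_space_free_scale)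
  note d = assms[unfolded tensor_null_def]
  have "r - p \<in> span (tensor_relations scale) \<longleftrightarrow> r - q \<in> span (tensor_relations scale)" for r
    using span_add[OF _ d, of "r - p"] span_diff[OF _ d, of "r - q"] by auto
  then show ?thesis by (simp add: tensor_class_def tensor_null_def)
qed

lemma tensor_add_class:
  fixes scale :: "'f::field \<Rightarrow> 'a::ab_group_add \<Rightarrow> 'a"
  shows "tensor_add scale (tensor_class scale p) (tensor_class scale q) = tensor_class scale (p + q)"
proof -
  interpret vector_space "free_scale :: 'f \<Rightarrow> _ \<Rightarrow> ('a \<times> 'a) \<Rightarrow>\<^sub>0 'f" by (rule vector_space_free_scale)
  have "tensor_class scale (p' + q') = tensor_class scale (p + q)"
    if "p' \<in> tensor_class scale p" "q' \<in> tensor_class scale q" for p' q'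
    using that span_add[of "p' - p" "tensor_relations scale" "q' - q"]
    by (intro tensor_class_eqI) (simp add: tensor_class_def tensor_null_def algebra_simps)
  then show ?thesis
    using tensor_class_self[of p scale] tensor_class_self[of q scale]
    unfolding tensor_add_def by blast
qed

lemma tensor_scale_class:
  fixes scale :: "'f::field \<Rightarrow> 'a::ab_group_add \<Rightarrow> 'a"
  shows "tensor_scale scale c (tensor_class scale p) = tensor_class scale (free_scale c p)"
proof -
  interpret vector_space "free_scale :: 'f \<Rightarrow> _ \<Rightarrow> ('a \<times> 'a) \<Rightarrow>\<^sub>0 'f" by (rule vector_space_free_scale)
  have "tensor_class scale (free_scale c p') = tensor_class scale (free_scale c p)"
    if "p' \<in> tensor_class scale p" for p'
    using that span_scale[of "p' - p" "tensor_relations scale" c]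
    by (intro tensor_class_eqI) (simp add: tensor_class_def tensor_null_def scale_right_diff_distrib)
  then show ?thesis
    using tensor_class_self[of p scale] unfolding tensor_scale_def by blast
qed

lemma tensor_lift_class:
  assumes t: "vector_space t" and \<beta>: "bilinear_map scale t \<beta>"
  shows "tensor_lift t \<beta> (tensor_class scale p) = free_lift t \<beta> p"
proof -
  interpret L: Vector_Spaces.linear free_scale t "free_lift t \<beta>" by (rule linear_free_lift[OF t])
  have "free_lift t \<beta> q = free_lift t \<beta> p" if "q \<in> tensor_class scale p" for q
    using free_lift_null[OF t \<beta>, of "q - p"] that by (simp add: tensor_class_def L.diff)
  then have "free_lift t \<beta> ` tensor_class scale p = (\<lambda>_. free_lift t \<beta> p) ` tensor_class scale p"
    by (rule image_cong[OF refl])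
  also have "\<dots> = {free_lift t \<beta> p}"
    by (rule image_constant[OF tensor_class_self])
  finally show ?thesis by (simp add: tensor_lift_def)
qed

lemma linear_tensor_lift_comultiplication:
  assumes s: "vector_space scale" and t: "vector_space t"
    and \<beta>: "bilinear_map scale t \<beta>" and \<Delta>: "comultiplication scale \<Delta>"
  shows "Vector_Spaces.linear scale t (\<lambda>a. tensor_lift t \<beta> (\<Delta> a))"
proof -
  interpret L: Vector_Spaces.linear free_scale t "free_lift t \<beta>" by (rule linear_free_lift[OF t])
  note lift = tensor_lift_class[OF t \<beta>]
  have cls: "\<exists>p. \<Delta> a = tensor_class scale p" for a
    using \<Delta> unfolding comultiplication_def tensors_def by blast
  have "tensor_lift t \<beta> (\<Delta> (a + b)) = tensor_lift t \<beta> (\<Delta> a) + tensor_lift t \<beta> (\<Delta> b)" for a b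
  proof -
    obtain p q where pq: "\<Delta> a = tensor_class scale p" "\<Delta> b = tensor_class scale q"
      using cls by blast
    then have "\<Delta> (a + b) = tensor_class scale (p + q)"
      using \<Delta> by (simp add: comultiplication_def tensor_add_class)
    then show ?thesis by (simp add: pq lift L.add)
  qed
  moreover have "tensor_lift t \<beta> (\<Delta> (scale c a)) = t c (tensor_lift t \<beta> (\<Delta> a))" for c a
  proof -
    obtain p where p: "\<Delta> a = tensor_class scale p"
      using cls by blast
    then have "\<Delta> (scale c a) = tensor_class scale (free_scale c p)"
      using \<Delta> by (simp add: comultiplication_def tensor_scale_class)
    then show ?thesis by (simp add: p lift L.scale)
  qed
  ultimately show ?thesis
    using s t by (auto intro!: Vector_Spaces.linear.intro
        simp: module_hom_def module_hom_axioms_def vector_space_def module_def)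
qed

end

(*
  The form <a + f, b + g> = g(a) + f(b) on D(A) is nondegenerate and invariant, <xy, z> = <x, yz>,
  so A1 and A2 are orthogonal complements of each other.  Hence neither meets A (an ideal that
  contains A would force its complement to lie in A), and by duality both project onto the dual;
  this makes phi and psi well defined, and -R(a) + psi(a) is the A1-component of a.

  The A1-component of ab equals u b, a u' and u u', where u and u' are the A1-components of a
  and b.  Comparing A-parts of these three expressions for R(ab), R(R(a) b) and R(a R(b)), and
  eliminating the terms with the two hit actions, leaves the Rota-Baxter identity.
*)

theory Submission
  imports Defs
begin

section \<open>Linear functionals and annihilators\<close>

context vector_space
begin

lemma dualD:
  assumes "f \<in> dual scale"
  shows "f (x + y) = f x + f y" "f (scale c x) = c * f x" "f 0 = 0"
    "f (\<Sum>i\<in>I. g i) = (\<Sum>i\<in>I. f (g i))"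
proof -
  interpret f: Vector_Spaces.linear scale "(*)" f using assms by (simp add: dual_def)
  show "f (x + y) = f x + f y" by (rule f.add)
  show "f (scale c x) = c * f x" by (rule f.scale)
  show "f 0 = 0" by (rule f.zero)
  show "f (\<Sum>i\<in>I. g i) = (\<Sum>i\<in>I. f (g i))" by (rule f.sum)
qed

lemma dualI:
  assumes "\<And>x y. f (x + y) = f x + f y" "\<And>c x. f (scale c x) = c * f x"
  shows "f \<in> dual scale"
  unfolding dual_def mem_Collect_eq
  by unfold_locales (simp_all add: assms algebra_simps)

lemma dual_closed:
  shows "0 \<in> dual scale"
    and "f \<in> dual scale \<Longrightarrow> g \<in> dual scale \<Longrightarrow> f + g \<in> dual scale"
  by (auto intro!: dualI simp: dualD algebra_simps)

text \<open>Since \<open>x\<close> lies outside \<open>S\<close>, adjoining it to a basis of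
  \<open>S\<close> keeps independence; prescribing 0 on the basis and 1 at \<open>x\<close> extends
  to a linear functional.\<close>

lemma subspace_separating_functional:
  assumes "subspace S" "x \<notin> S"
  obtains h where "h \<in> dual scale" "\<And>y. y \<in> S \<Longrightarrow> h y = 0" "h x = 1"
proof -
  interpret vector_space_pair scale "(*)"
    by unfold_locales (auto simp: algebra_simps)
  obtain B where B: "B \<subseteq> S" "independent B" "S \<subseteq> span B"
    using basis_exists[of S] by metis
  then have span_B: "span B = S" using assms(1) by (metis span_minimal subset_antisym)
  have "independent (insert x B)"
    using B assms(2) span_B by (metis independent_insertI)
  from linear_independent_extend[OF this, of "\<lambda>y. if y = x then 1 else 0"]
  obtain h where h: "Vector_Spaces.linear scale (*) h"
      and hx: "\<And>y. y \<in> insert x B \<Longrightarrow> h y = (if y = x then 1 else 0)"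
    by blast
  have "h y = 0" if "y \<in> S" for y
    by (rule linear_eq_0_on_span[OF h, of B])
       (use that span_B hx B assms(2) in auto)
  with h hx that show ?thesis by (auto simp: dual_def)
qed

lemma dual_separates:
  assumes "\<And>f. f \<in> dual scale \<Longrightarrow> f x = 0"
  shows "x = 0"
proof (rule ccontr)
  assume "x \<noteq> 0"
  then obtain h where "h \<in> dual scale" "h x = 1"
    using subspace_separating_functional[of "{0}" x] subspace_0 subspace_single_0 by auto
  with assms show False by force
qed

text \<open>A basis \<open>B\<close> identifies the dual with the space itself through
  \<open>f \<mapsto> \<Sum>b\<in>B. f(b) b\<close>; a functional that vanishes on the image of a proper subspace
  is then a nonzero vector in its annihilator.\<close>

lemma dual_subspace_eq_if_trivial_annihilator:
  assumes "finite C" "span C = UNIV"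
    and P: "P \<subseteq> dual scale" "0 \<in> P" "\<And>f g. f \<in> P \<Longrightarrow> g \<in> P \<Longrightarrow> f + g \<in> P"
      "\<And>c f. f \<in> P \<Longrightarrow> (\<lambda>x. c * f x) \<in> P"
    and ann: "\<And>x. (\<And>f. f \<in> P \<Longrightarrow> f x = 0) \<Longrightarrow> x = 0"
  shows "P = dual scale"
proof (rule ccontr)
  assume "P \<noteq> dual scale"
  then obtain f where f: "f \<in> dual scale" "f \<notin> P" using P(1) by auto
  obtain B where B: "B \<subseteq> C" "independent B" "C \<subseteq> span B"
    using maximal_independent_subset[of C] by blast
  have fin: "finite B" using B(1) assms(1) finite_subset by blast
  have span_B: "span B = UNIV"
    using B(3) assms(2) by (metis span_mono span_span top.extremum_uniqueI)
  define T where "T g = (\<Sum>b\<in>B. scale (g b) b)" for g :: "'b \<Rightarrow> 'a"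
  have T_add: "T (g + h) = T g + T h" for g h
    by (simp add: T_def scale_left_distrib sum.distrib)
  have T_scale: "T (\<lambda>x. c * g x) = scale c (T g)" for c g
    by (simp add: T_def scale_sum_right)
  \<comment> \<open>Both sides are the sum of \<open>g b * h b\<close> over the basis
    \<open>B\<close>.\<close>
  have eval: "g (T h) = h (T g)" if "g \<in> dual scale" "h \<in> dual scale" for g h
    using that by (simp add: T_def dualD mult.commute)
  have T_inj: "g = h" if gh: "g \<in> dual scale" "h \<in> dual scale" "T g = T h" for g h
  proof -
    have "(\<Sum>b\<in>B. scale (g b - h b) b) = 0"
      using gh(3) by (simp add: T_def scale_left_diff_distrib sum_subtractf)
    then have on_B: "g b = h b" if "b \<in> B" for b
      using independentD[OF B(2) fin subset_refl, of "\<lambda>b. g b - h b"] that by simp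
    interpret vector_space_pair scale "(*)"
      by unfold_locales (auto simp: algebra_simps)
    have "g x = h x" for x
      by (rule linear_eq_on_span[of g h B]) (use gh on_B span_B in \<open>auto simp: dual_def\<close>)
    then show ?thesis by auto
  qed
  have "subspace (T ` P)"
  proof (rule subspaceI)
    show "0 \<in> T ` P" using P(2) by (force simp: T_def)
    show "x + y \<in> T ` P" if "x \<in> T ` P" "y \<in> T ` P" for x y
      using that P(3) by (auto simp flip: T_add)
    show "scale c x \<in> T ` P" if "x \<in> T ` P" for c x
      using that P(4) by (auto simp flip: T_scale)
  qed
  moreover have "T f \<notin> T ` P" using f T_inj P(1) by blast
  ultimately obtain h where h: "h \<in> dual scale" "\<And>y. y \<in> T ` P \<Longrightarrow> h y = 0" "h (T f) = 1"
    using subspace_separating_functional by blast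
  \<comment> \<open>By symmetry \<open>g (T h) = h (T g) = 0\<close> for \<open>g\<close> in
    \<open>P\<close>, so \<open>T h\<close> is annihilated by \<open>P\<close>; yet
    \<open>f (T h) = h (T f) = 1\<close>.\<close>
  have "T h = 0"
  proof (rule ann)
    fix g assume "g \<in> P"
    then show "g (T h) = 0" using eval[of g h] h P(1) by auto
  qed
  with h(3) eval[OF f(1) h(1)] dualD(3)[OF f(1)] show False by simp
qed

end

section \<open>Calculus in the Drinfeld double\<close>

locale drinfeld_double = fd_algebra scale mult
  for scale :: "'f::field \<Rightarrow> 'a::ab_group_add \<Rightarrow> 'a" and mult :: "'a \<Rightarrow> 'a \<Rightarrow> 'a" +
  fixes \<Delta> :: "'a \<Rightarrow> (('a \<times> 'a) \<Rightarrow>\<^sub>0 'f) set"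
  assumes comult: "comultiplication scale \<Delta>"
begin

abbreviation dmult (infixl "\<odot>" 70) where "u \<odot> v \<equiv> double_mult scale mult \<Delta> u v"
abbreviation "carr \<equiv> double_carrier scale"
abbreviation "dideal \<equiv> is_ideal (double_scale scale) (double_mult scale mult \<Delta>)"
abbreviation "dsimple \<equiv> simple_algebra (double_scale scale) (double_mult scale mult \<Delta>)"

lemma mult_linear:
  "mult (x + y) z = mult x z + mult y z" "mult x (y + z) = mult x y + mult x z"
  "mult (- x) z = - mult x z" "mult x (- z) = - mult x z"
  "mult 0 z = 0" "mult x 0 = 0"
proof -
  interpret l: Vector_Spaces.linear scale scale "\<lambda>x. mult x z"
    using bilinear_mult by (simp add: bilinear_map_def)
  interpret r: Vector_Spaces.linear scale scale "mult x"
    using bilinear_mult by (simp add: bilinear_map_def)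
  show "mult (x + y) z = mult x z + mult y z" "mult x (y + z) = mult x y + mult x z"
    "mult (- x) z = - mult x z" "mult x (- z) = - mult x z" "mult 0 z = 0" "mult x 0 = 0"
    by (rule l.add r.add l.neg r.neg l.zero r.zero)+
qed

lemma bilinear_hit_left:
  "f \<in> dual scale \<Longrightarrow> bilinear_map scale scale (\<lambda>x y. scale (f y) x)"
  unfolding bilinear_map_def
  by (intro conjI allI; unfold_locales)
     (auto simp: dualD scale_left_distrib scale_right_distrib mult.commute)

lemma bilinear_hit_right:
  "f \<in> dual scale \<Longrightarrow> bilinear_map scale scale (\<lambda>x y. scale (f x) y)"
  unfolding bilinear_map_def
  by (intro conjI allI; unfold_locales)
     (auto simp: dualD scale_left_distrib scale_right_distrib mult.commute)

lemma bilinear_dual_mult: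
  "f \<in> dual scale \<Longrightarrow> g \<in> dual scale \<Longrightarrow> bilinear_map scale (*) (\<lambda>x y. f x * g y)"
  unfolding bilinear_map_def
  by (intro conjI allI; unfold_locales) (auto simp: dualD algebra_simps)

lemma vector_space_field: "vector_space ((*) :: 'f \<Rightarrow> 'f \<Rightarrow> 'f)"
  by unfold_locales (auto simp: algebra_simps)

text \<open>A single representative \<open>p\<close> of \<open>\<Delta> a\<close> serves all
  functionals at once, so identities between the actions and the dual product can be checked
  termwise on the same finite sum.\<close>

lemma sweedler:
  obtains p where "\<And>f. f \<in> dual scale \<Longrightarrow> hit_left scale \<Delta> f a =
       (\<Sum>k\<in>Poly_Mapping.keys p. scale (Poly_Mapping.lookup p k) (scale (f (snd k)) (fst k)))"
    "\<And>f. f \<in> dual scale \<Longrightarrow> hit_right scale \<Delta> a f =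
       (\<Sum>k\<in>Poly_Mapping.keys p. scale (Poly_Mapping.lookup p k) (scale (f (fst k)) (snd k)))"
    "\<And>f g. f \<in> dual scale \<Longrightarrow> g \<in> dual scale \<Longrightarrow> dual_mult \<Delta> f g a =
       (\<Sum>k\<in>Poly_Mapping.keys p. Poly_Mapping.lookup p k * (f (fst k) * g (snd k)))"
proof -
  obtain p where p: "\<Delta> a = tensor_class scale p"
    using comult unfolding comultiplication_def tensors_def by blast
  show ?thesis
    by (rule that[of p])
       (simp_all add: p hit_left_def hit_right_def dual_mult_def free_lift_def
         tensor_lift_class[OF vector_space_axioms bilinear_hit_left]
         tensor_lift_class[OF vector_space_axioms bilinear_hit_right]
         tensor_lift_class[OF vector_space_field bilinear_dual_mult])
qed

text \<open>In Sweedler notation both sides are the sum of \<open>h(a1) f(a2)\<close>.\<close>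

lemma dual_hit_left_eq_dual_mult:
  assumes "f \<in> dual scale" "h \<in> dual scale"
  shows "h (hit_left scale \<Delta> f a) = dual_mult \<Delta> h f a"
  by (rule sweedler[of a]) (simp add: assms dualD mult.commute mult.left_commute)

text \<open>In Sweedler notation both sides are the sum of \<open>f(a1) h(a2)\<close>.\<close>

lemma dual_hit_right_eq_dual_mult:
  assumes "f \<in> dual scale" "h \<in> dual scale"
  shows "h (hit_right scale \<Delta> a f) = dual_mult \<Delta> f h a"
  by (rule sweedler[of a]) (simp add: assms dualD mult.assoc)

lemma hit_left_linear:
  assumes "f \<in> dual scale"
  shows "hit_left scale \<Delta> f (a + b) = hit_left scale \<Delta> f a + hit_left scale \<Delta> f b"
    "hit_left scale \<Delta> f (- a) = - hit_left scale \<Delta> f a" "hit_left scale \<Delta> f 0 = 0"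
proof -
  interpret l: Vector_Spaces.linear scale scale "hit_left scale \<Delta> f"
    using linear_tensor_lift_comultiplication[OF vector_space_axioms vector_space_axioms
        bilinear_hit_left[OF assms] comult] by (simp add: hit_left_def[abs_def])
  show "hit_left scale \<Delta> f (a + b) = hit_left scale \<Delta> f a + hit_left scale \<Delta> f b"
    "hit_left scale \<Delta> f (- a) = - hit_left scale \<Delta> f a" "hit_left scale \<Delta> f 0 = 0"
    by (rule l.add l.neg l.zero)+
qed

lemma hit_right_linear:
  assumes "f \<in> dual scale"
  shows "hit_right scale \<Delta> (a + b) f = hit_right scale \<Delta> a f + hit_right scale \<Delta> b f"
    "hit_right scale \<Delta> (- a) f = - hit_right scale \<Delta> a f" "hit_right scale \<Delta> 0 f = 0"
proof -
  interpret l: Vector_Spaces.linear scale scale "\<lambda>a. hit_right scale \<Delta> a f"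
    using linear_tensor_lift_comultiplication[OF vector_space_axioms vector_space_axioms
        bilinear_hit_right[OF assms] comult] by (simp add: hit_right_def[abs_def])
  show "hit_right scale \<Delta> (a + b) f = hit_right scale \<Delta> a f + hit_right scale \<Delta> b f"
    "hit_right scale \<Delta> (- a) f = - hit_right scale \<Delta> a f" "hit_right scale \<Delta> 0 f = 0"
    by (rule l.add l.neg l.zero)+
qed

text \<open>Additivity in the functional is read off a fixed representative of
  \<open>\<Delta> a\<close>; additivity in the vector rests on the linearity of
  \<open>\<Delta>\<close>.\<close>

lemma hit_functional_add:
  assumes "f \<in> dual scale" "g \<in> dual scale"
  shows "hit_left scale \<Delta> (f + g) a = hit_left scale \<Delta> f a + hit_left scale \<Delta> g a"
    and "hit_right scale \<Delta> a (f + g) = hit_right scale \<Delta> a f + hit_right scale \<Delta> a g"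
  by (rule sweedler[of a]; simp add: assms dual_closed scale_left_distrib scale_right_distrib
      sum.distrib del: scale_scale)+

lemma hit_functional_zero:
  "hit_left scale \<Delta> 0 a = 0" "hit_right scale \<Delta> a 0 = 0"
  by (rule sweedler[of a]; simp add: dual_closed)+

lemma dual_mult_add:
  assumes "f \<in> dual scale" "g \<in> dual scale" "h \<in> dual scale"
  shows "dual_mult \<Delta> (f + g) h = dual_mult \<Delta> f h + dual_mult \<Delta> g h"
    and "dual_mult \<Delta> h (f + g) = dual_mult \<Delta> h f + dual_mult \<Delta> h g"
proof -
  show "dual_mult \<Delta> (f + g) h = dual_mult \<Delta> f h + dual_mult \<Delta> g h"
  proof
    fix a
    show "dual_mult \<Delta> (f + g) h a = (dual_mult \<Delta> f h + dual_mult \<Delta> g h) a"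
      by (rule sweedler[of a]) (simp add: assms dual_closed algebra_simps sum.distrib)
  qed
  show "dual_mult \<Delta> h (f + g) = dual_mult \<Delta> h f + dual_mult \<Delta> h g"
  proof
    fix a
    show "dual_mult \<Delta> h (f + g) a = (dual_mult \<Delta> h f + dual_mult \<Delta> h g) a"
      by (rule sweedler[of a]) (simp add: assms dual_closed algebra_simps sum.distrib)
  qed
qed

lemma dual_mult_zero: "dual_mult \<Delta> 0 0 = 0"
proof
  fix a
  show "dual_mult \<Delta> 0 0 a = 0 a"
    by (rule sweedler[of a]) (simp add: dual_closed)
qed

lemma carr_iff: "u \<in> carr \<longleftrightarrow> snd u \<in> dual scale"
  by (cases u) (simp add: double_carrier_def)

lemma dmult_add:
  assumes "u \<in> carr" "v \<in> carr" "w \<in> carr"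
  shows "(u + v) \<odot> w = u \<odot> w + v \<odot> w" "w \<odot> (u + v) = w \<odot> u + w \<odot> v"
  using assms
  by (auto simp: carr_iff double_mult_def split_beta prod_eq_iff mult_linear hit_left_linear
      hit_right_linear hit_functional_add dual_mult_add dual_hit_left_def dual_hit_right_def
      fun_eq_iff dualD algebra_simps)

lemma dmult_base: "(a, 0) \<odot> (b, 0) = (mult a b, 0)"
  by (auto simp: double_mult_def hit_functional_zero dual_mult_zero dual_hit_left_def
      dual_hit_right_def fun_eq_iff)

section \<open>The invariant bilinear form on the double\<close>

definition pairing :: "'a \<times> ('a \<Rightarrow> 'f) \<Rightarrow> 'a \<times> ('a \<Rightarrow> 'f) \<Rightarrow> 'f" where
  "pairing u v = snd v (fst u) + snd u (fst v)"

lemma pairing_commute: "pairing u v = pairing v u"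
  by (simp add: pairing_def)

lemma pairing_linear:
  assumes "v \<in> carr"
  shows "pairing (u + u') v = pairing u v + pairing u' v"
    "pairing (double_scale scale c u) v = c * pairing u v" "pairing 0 v = 0"
  using assms by (simp_all add: carr_iff pairing_def double_scale_def dualD algebra_simps)

text \<open>For \<open>u = (a, f)\<close>, \<open>v = (b, g)\<close>, \<open>w = (c, h)\<close> both
  sides expand to the same six terms: h(ab), f(bc), g(ca) and the dual products (hf)(b), (gh)(a),
  (fg)(c).\<close>

lemma pairing_invariant:
  assumes "u \<in> carr" "v \<in> carr" "w \<in> carr"
  shows "pairing (u \<odot> v) w = pairing u (v \<odot> w)"
  using assms
  by (simp add: carr_iff pairing_def double_mult_def split_beta dualD dual_hit_left_def
      dual_hit_right_def dual_hit_left_eq_dual_mult dual_hit_right_eq_dual_mult)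

text \<open>Pairing with \<open>(a, 0)\<close> evaluates the functional part at \<open>a\<close>;
  pairing with \<open>(0, f)\<close> applies \<open>f\<close> to the vector part, and functionals
  separate points.\<close>

lemma pairing_nondegenerate:
  assumes "u \<in> carr" "\<And>v. v \<in> carr \<Longrightarrow> pairing u v = 0"
  shows "u = 0"
proof -
  have "snd u a = 0" for a
    using assms(2)[of "(a, 0)"] by (simp add: carr_iff pairing_def dual_closed)
  moreover have "fst u = 0"
  proof (rule dual_separates)
    fix f assume "f \<in> dual scale"
    then show "f (fst u) = 0"
      using assms(2)[of "(0, f)"] assms(1) by (simp add: carr_iff pairing_def dualD)
  qed
  ultimately show ?thesis by (auto simp: prod_eq_iff)
qed

end

section \<open>Orthogonality of the two simple ideals and their intersection with the base
  algebra\<close>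

locale decomposed_double = drinfeld_double scale mult \<Delta>
  for scale :: "'f::field \<Rightarrow> 'a::ab_group_add \<Rightarrow> 'a" and mult \<Delta> +
  fixes I J :: "('a \<times> ('a \<Rightarrow> 'f)) set"
  assumes simple: "simple_algebra scale mult UNIV"
    and I: "dideal carr I" and J: "dideal carr J"
    and simple_I: "dsimple I" and simple_J: "dsimple J"
    and direct_sum: "is_direct_sum carr I J"
begin

text \<open>The hypotheses are symmetric in the two ideals, so each result about \<open>I\<close>
  also holds for \<open>J\<close> through this instance.\<close>

lemma swap: "decomposed_double scale mult \<Delta> J I"
proof unfold_locales
  show "is_direct_sum carr J I"
    using direct_sum unfolding is_direct_sum_def
    by (simp add: Int_commute) (metis (no_types, lifting) add.commute)
qed (fact simple I J simple_I simple_J)+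

sublocale D: vector_space "double_scale scale"
  by (rule vector_space_double_scale) (rule vector_space_axioms)

lemma ideal_subspace: "D.subspace I"
  using I by (simp add: is_ideal_def)

lemma ideal_carr: "u \<in> I \<Longrightarrow> u \<in> carr"
  using I by (auto simp: is_ideal_def)

lemma ideal_mult: "u \<in> carr \<Longrightarrow> v \<in> I \<Longrightarrow> u \<odot> v \<in> I" "u \<in> carr \<Longrightarrow> v \<in> I \<Longrightarrow> v \<odot> u \<in> I"
  using I by (auto simp: is_ideal_def)

lemma ideals_disjoint: "u \<in> I \<Longrightarrow> u \<in> J \<Longrightarrow> u = 0"
  using direct_sum by (auto simp: is_direct_sum_def)

lemma decompose:
  assumes "w \<in> carr"
  obtains u v where "u \<in> I" "v \<in> J" "w = u + v"
  using assms direct_sum by (auto simp: is_direct_sum_def)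

text \<open>The product lies in both ideals, which meet only in 0.\<close>

lemma ideals_mult: "u \<in> I \<Longrightarrow> v \<in> J \<Longrightarrow> u \<odot> v = 0"
proof -
  interpret swap: decomposed_double scale mult \<Delta> J I by (rule swap)
  show "u \<in> I \<Longrightarrow> v \<in> J \<Longrightarrow> u \<odot> v = 0"
    by (rule ideals_disjoint) (simp_all add: ideal_mult swap.ideal_mult ideal_carr swap.ideal_carr)
qed

text \<open>The products in \<open>I\<close> are orthogonal to \<open>J\<close> because \<open>IJ = 0\<close> and the pairing is invariant,
  so the part of \<open>I\<close> orthogonal to \<open>J\<close> is a nonzero ideal of \<open>I\<close>.\<close>

lemma ideals_orthogonal:
  assumes "u \<in> I" "v \<in> J"
  shows "pairing u v = 0"
proof -
  interpret swap: decomposed_double scale mult \<Delta> J I by (rule swap)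
  define K where "K = {u \<in> I. \<forall>v\<in>J. pairing u v = 0}"
  have prod: "x \<odot> y \<in> K" if "x \<in> I" "y \<in> I" for x y
    using that by (auto simp: K_def ideal_mult ideal_carr swap.ideal_carr pairing_invariant
        ideals_mult pairing_linear pairing_commute[of _ 0])
  have "D.subspace K"
    using ideal_subspace unfolding D.subspace_def K_def
    by (auto simp: pairing_linear swap.ideal_carr)
  then have "dideal I K"
    unfolding is_ideal_def using prod by (auto simp: K_def)
  moreover obtain x y where "x \<in> I" "y \<in> I" "x \<odot> y \<noteq> 0"
    using simple_I by (auto simp: simple_algebra_def)
  ultimately have "K = I"
    using simple_I prod unfolding simple_algebra_def by blast
  with assms show ?thesis by (auto simp: K_def)
qed

text \<open>The \<open>I\<close>-component of \<open>w\<close> is orthogonal to \<open>I\<close>,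
  because \<open>w\<close> and its \<open>J\<close>-component are, and to \<open>J\<close> by
  \<open>ideals_orthogonal\<close>. Nondegeneracy makes it vanish.\<close>

lemma orthogonal_subset:
  assumes "w \<in> carr" "\<And>u. u \<in> I \<Longrightarrow> pairing w u = 0"
  shows "w \<in> J"
proof -
  interpret swap: decomposed_double scale mult \<Delta> J I by (rule swap)
  obtain u v where uv: "u \<in> I" "v \<in> J" "w = u + v" using decompose[OF assms(1)] .
  have "u = 0"
  proof (rule pairing_nondegenerate)
    show "u \<in> carr" using uv ideal_carr by blast
    fix z assume "z \<in> carr"
    then obtain x y where xy: "x \<in> I" "y \<in> J" "z = x + y" using decompose by blast
    have "pairing u x = pairing w x"
      using uv xy ideals_orthogonal[of x v] pairing_linear(1)[OF ideal_carr[OF xy(1)], of u v]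
      by (simp add: pairing_commute[of x])
    then show "pairing u z = 0"
      using xy assms(2)[OF xy(1)] ideals_orthogonal[OF uv(1) xy(2)]
        pairing_linear(1)[OF ideal_carr[OF uv(1)], of x y]
      by (simp add: pairing_commute[of _ u])
  qed
  with uv show ?thesis by simp
qed

text \<open>The intersection of \<open>I\<close> with the base algebra is an ideal of a simple
  algebra. Were it everything, orthogonality would kill the functional parts in \<open>J\<close>, so
  \<open>J\<close> would lie in \<open>I\<close> and be zero, against the nonzero product that
  simplicity provides in \<open>J\<close>.\<close>

lemma ideal_Int_base:
  assumes "(a, 0) \<in> I"
  shows "a = 0"
proof -
  interpret swap: decomposed_double scale mult \<Delta> J I by (rule swap)
  define K where "K = {a. (a, 0) \<in> I}"
  have base: "(x, 0) \<in> carr" for x by (simp add: carr_iff dual_closed)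
  have "subspace K"
  proof (rule subspaceI)
    show "0 \<in> K" using D.subspace_0[OF ideal_subspace] by (simp add: K_def zero_prod_def)
    show "x + y \<in> K" if "x \<in> K" "y \<in> K" for x y
      using that D.subspace_add[OF ideal_subspace, of "(x, 0)" "(y, 0)"] by (simp add: K_def)
    show "scale c x \<in> K" if "x \<in> K" for c x
      using that D.subspace_scale[OF ideal_subspace, of "(x, 0)" c]
      by (simp add: K_def double_scale_def zero_fun_def)
  qed
  moreover have "mult x y \<in> K" "mult y x \<in> K" if "y \<in> K" for x y
    using ideal_mult[OF base[of x], of "(y, 0)"] that by (simp_all add: K_def dmult_base)
  ultimately have "is_ideal scale mult UNIV K" by (simp add: is_ideal_def)
  then consider "K = {0}" | "K = UNIV" using simple by (auto simp: simple_algebra_def)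
  then show ?thesis
  proof cases
    case 1
    then show ?thesis using assms by (auto simp: K_def)
  next
    case 2
    have "v = 0" if v: "v \<in> J" for v
    proof -
      have "snd v x = 0" for x
        using ideals_orthogonal[of "(x, 0)" v] v 2 by (auto simp: K_def pairing_def)
      then have "v = (fst v, 0)" by (auto simp: prod_eq_iff)
      then have "v \<in> I" using 2 K_def by (metis UNIV_I mem_Collect_eq)
      then show ?thesis using v ideals_disjoint by blast
    qed
    moreover obtain x y where "x \<in> J" "y \<in> J" "x \<odot> y \<noteq> 0"
      using simple_J by (auto simp: simple_algebra_def)
    ultimately show ?thesis
      using swap.ideal_mult(1)[OF swap.ideal_carr] by blast
  qed
qed

section \<open>Projection of the ideals onto the dual; computation of \<open>phi\<close> and
  \<open>psi\<close>\<close>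

text \<open>The difference has zero functional part, so \<open>ideal_Int_base\<close> applies. This
  is the uniqueness behind \<open>phi\<close>.\<close>

lemma ideal_eqI_snd:
  assumes "u \<in> I" "v \<in> I" "snd u = snd v"
  shows "u = v"
proof -
  have "u - v \<in> I" using D.subspace_diff[OF ideal_subspace assms(1,2)] .
  moreover have "u - v = (fst u - fst v, 0)" using assms(3) by (simp add: prod_eq_iff)
  ultimately have "fst u - fst v = 0" using ideal_Int_base by metis
  with assms(3) show ?thesis by (simp add: prod_eq_iff)
qed

text \<open>A vector \<open>x\<close> killed by all these functional parts makes
  \<open>(x, 0)\<close> orthogonal to \<open>I\<close>, hence an element of \<open>J\<close>, hence
  zero. Finite dimension then gives the whole dual.\<close>

lemma snd_ideal: "snd ` I = dual scale"
proof -
  interpret swap: decomposed_double scale mult \<Delta> J I by (rule swap)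
  obtain C where C: "finite C" "span C = UNIV" using finite_dim by blast
  show ?thesis
  proof (rule dual_subspace_eq_if_trivial_annihilator[OF C])
    show "snd ` I \<subseteq> dual scale" using ideal_carr carr_iff by blast
    show "0 \<in> snd ` I" using D.subspace_0[OF ideal_subspace] by force
    show "f + g \<in> snd ` I" if fg: "f \<in> snd ` I" "g \<in> snd ` I" for f g
    proof -
      obtain u v where "u \<in> I" "v \<in> I" "f = snd u" "g = snd v" using fg by blast
      then show ?thesis using D.subspace_add[OF ideal_subspace] by (metis imageI snd_add)
    qed
    show "(\<lambda>x. c * f x) \<in> snd ` I" if f: "f \<in> snd ` I" for c f
    proof -
      obtain u where "u \<in> I" "f = snd u" using f by blast
      then have "double_scale scale c u \<in> I" "snd (double_scale scale c u) = (\<lambda>x. c * f x)"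
        using D.subspace_scale[OF ideal_subspace] by (auto simp: double_scale_def)
      then show ?thesis by (metis imageI)
    qed
    fix x assume "\<And>f. f \<in> snd ` I \<Longrightarrow> f x = 0"
    then have "(x, 0) \<in> J"
      by (intro orthogonal_subset) (auto simp: carr_iff dual_closed pairing_def)
    then show "x = 0" by (rule swap.ideal_Int_base)
  qed
qed

text \<open>The minus sign comes from the convention that \<open>f - phi I f\<close>, not the sum,
  lies in \<open>I\<close>.\<close>

lemma phi_eqI:
  assumes "u \<in> I"
  shows "phi I (snd u) = - fst u"
  unfolding phi_def
proof (rule the_equality)
  show "(0, snd u) - (- fst u, 0) \<in> I" using assms by simp
  fix a assume "(0, snd u) - (a, 0) \<in> I"
  then have "(0, snd u) - (a, 0) = u"
    by (rule ideal_eqI_snd[OF _ assms]) simp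
  then have "- a = fst u" by (auto simp: prod_eq_iff)
  then show "a = - fst u" by (metis minus_minus)
qed

text \<open>If \<open>a = u + v\<close> with \<open>u \<in> I\<close> and \<open>v \<in> J\<close>, then \<open>u = \<psi>(a) - \<phi>\<^sub>1(\<psi>(a))\<close>.\<close>

lemma psi_eqI:
  assumes u: "u \<in> I" and v: "v \<in> J" and a: "(a, 0) = u + v"
  shows "psi scale I J a = snd u"
  unfolding psi_def
proof (rule the_equality)
  interpret swap: decomposed_double scale mult \<Delta> J I by (rule swap)
  \<comment> \<open>Since \<open>(a, 0)\<close> has zero functional part, \<open>- v\<close> is an
    element of \<open>J\<close> with the same functional part as \<open>u\<close>, which determines
    \<open>phi J (snd u)\<close>.\<close>
  have minus_v: "- v \<in> J" using D.subspace_neg[OF swap.ideal_subspace v] .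
  have snd_u: "snd u = snd (- v)" using a by (simp add: prod_eq_iff eq_neg_iff_add_eq_0)
  have phi_J: "phi J (snd u) = fst v" using swap.phi_eqI[OF minus_v] snd_u by simp
  have fst_a: "a = fst u + fst v" using a by (simp add: prod_eq_iff)
  show "snd u \<in> dual scale \<and> a = - phi I (snd u) + phi J (snd u)"
    using ideal_carr[OF u] phi_J phi_eqI[OF u] fst_a by (simp add: carr_iff)
  fix f assume f: "f \<in> dual scale \<and> a = - phi I f + phi J f"
  then obtain x y where xy: "x \<in> I" "f = snd x" "y \<in> J" "f = snd y"
    using snd_ideal swap.snd_ideal by (metis imageE)
  \<comment> \<open>The equation for \<open>a\<close> says that \<open>(a, 0) = x - y\<close>.
    Comparing the two decompositions puts \<open>u - x\<close> in both ideals.\<close>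
  then have "u + v = x - y"
    using f phi_eqI[of x] swap.phi_eqI[of y] by (simp flip: a add: prod_eq_iff)
  then have "u - x = - y - v" by (simp add: algebra_simps)
  moreover have "u - x \<in> I" using D.subspace_diff[OF ideal_subspace u xy(1)] .
  moreover have "- y - v \<in> J"
    using D.subspace_diff[OF swap.ideal_subspace D.subspace_neg[OF swap.ideal_subspace xy(3)] v] .
  ultimately have "u - x = 0" using ideals_disjoint by metis
  with xy show "f = snd u" by simp
qed

section \<open>The operator \<open>R\<close> and the Rota-Baxter identity\<close>

definition R :: "'a \<Rightarrow> 'a" where "R a = phi I (psi scale I J a)"

text \<open>Evaluating \<open>R\<close> thus amounts to exhibiting a decomposition along
  \<open>I\<close> and \<open>J\<close>; the proofs below all do this.\<close>

lemma R_eqI: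
  assumes "u \<in> I" "v \<in> J" "(a, 0) = u + v"
  shows "R a = - fst u"
  using psi_eqI[OF assms] phi_eqI[OF assms(1)] by (simp add: R_def)

text \<open>By \<open>psi_eqI\<close> the functional \<open>f\<close> obtained here is
  \<open>psi scale I J a\<close>.\<close>

lemma R_decompose:
  obtains f v where "(- R a, f) \<in> I" "v \<in> J" "(a, 0) = (- R a, f) + v" "f \<in> dual scale"
proof -
  have "(a, 0) \<in> carr" by (simp add: carr_iff dual_closed)
  then obtain u v where uv: "u \<in> I" "v \<in> J" "(a, 0) = u + v" using decompose by blast
  have "u = (- R a, snd u)" using R_eqI[OF uv] by simp
  moreover have "snd u \<in> dual scale" using ideal_carr[OF uv(1)] by (simp add: carr_iff)
  ultimately show ?thesis using that[of "snd u" v] uv by metis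
qed

lemma R_linear: "R (a + b) = R a + R b" "R (scale c a) = scale c (R a)"
proof -
  interpret swap: decomposed_double scale mult \<Delta> J I by (rule swap)
  obtain f v where a: "(- R a, f) \<in> I" "v \<in> J" "(a, 0) = (- R a, f) + v"
    by (rule R_decompose)
  obtain g w where b: "(- R b, g) \<in> I" "w \<in> J" "(b, 0) = (- R b, g) + w"
    by (rule R_decompose)
  have "R (a + b) = - fst ((- R a, f) + (- R b, g))"
  proof (rule R_eqI)
    show "(- R a, f) + (- R b, g) \<in> I" using D.subspace_add[OF ideal_subspace a(1) b(1)] .
    show "v + w \<in> J" using D.subspace_add[OF swap.ideal_subspace a(2) b(2)] .
    have "(a + b, 0) = (a, 0) + (b, 0 :: 'a \<Rightarrow> 'f)" by simp
    then show "(a + b, 0) = (- R a, f) + (- R b, g) + (v + w)"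
      unfolding a(3) b(3) by (simp only: ac_simps)
  qed
  then show "R (a + b) = R a + R b" by simp
  have "R (scale c a) = - fst (double_scale scale c (- R a, f))"
  proof (rule R_eqI)
    show "double_scale scale c (- R a, f) \<in> I"
      using D.subspace_scale[OF ideal_subspace a(1)] .
    show "double_scale scale c v \<in> J" using D.subspace_scale[OF swap.ideal_subspace a(2)] .
    have "(scale c a, 0) = double_scale scale c (a, 0)"
      by (simp add: double_scale_def zero_fun_def)
    then show "(scale c a, 0) = double_scale scale c (- R a, f) + double_scale scale c v"
      unfolding a(3) by (simp only: D.scale_right_distrib)
  qed
  then show "R (scale c a) = scale c (R a)" by (simp add: double_scale_def)
qed

text \<open>Multiplying the decomposition of \<open>(a, 0)\<close> by \<open>(b, 0)\<close> keeps
  each summand in its ideal, so it decomposes \<open>(mult a b, 0)\<close>.\<close>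

lemma R_mult_left:
  assumes "(- R a, f) \<in> I" "v \<in> J" "(a, 0) = (- R a, f) + v"
  shows "R (mult a b) = - fst ((- R a, f) \<odot> (b, 0))"
proof (rule R_eqI)
  interpret swap: decomposed_double scale mult \<Delta> J I by (rule swap)
  have b: "(b, 0) \<in> carr" by (simp add: carr_iff dual_closed)
  show "(- R a, f) \<odot> (b, 0) \<in> I" "v \<odot> (b, 0) \<in> J"
    using ideal_mult swap.ideal_mult b assms by blast+
  show "(mult a b, 0) = (- R a, f) \<odot> (b, 0) + v \<odot> (b, 0)"
    using dmult_add(1)[OF ideal_carr[OF assms(1)] swap.ideal_carr[OF assms(2)] b] assms(3) dmult_base
    by metis
qed

text \<open>The mirror image: here the decomposition of the right factor is used.\<close>

lemma R_mult_right:
  assumes "(- R b, g) \<in> I" "v \<in> J" "(b, 0) = (- R b, g) + v"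
  shows "R (mult a b) = - fst ((a, 0) \<odot> (- R b, g))"
proof (rule R_eqI)
  interpret swap: decomposed_double scale mult \<Delta> J I by (rule swap)
  have a: "(a, 0) \<in> carr" by (simp add: carr_iff dual_closed)
  show "(a, 0) \<odot> (- R b, g) \<in> I" "(a, 0) \<odot> v \<in> J"
    using ideal_mult swap.ideal_mult a assms by blast+
  show "(mult a b, 0) = (a, 0) \<odot> (- R b, g) + (a, 0) \<odot> v"
    using dmult_add(2)[OF ideal_carr[OF assms(1)] swap.ideal_carr[OF assms(2)] a] assms(3) dmult_base
    by metis
qed

lemma R_rota_baxter: "mult (R a) (R b) = R (mult (R a) b + mult a (R b) + mult a b)"
proof -
  interpret swap: decomposed_double scale mult \<Delta> J I by (rule swap)
  obtain f v where a: "(- R a, f) \<in> I" "v \<in> J" "(a, 0) = (- R a, f) + v" "f \<in> dual scale"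
    by (rule R_decompose)
  obtain g w where b: "(- R b, g) \<in> I" "w \<in> J" "(b, 0) = (- R b, g) + w" "g \<in> dual scale"
    by (rule R_decompose)
  note simps = double_mult_def mult_linear hit_left_linear hit_right_linear hit_functional_zero
    dual_closed a(4) b(4)
  \<comment> \<open>\<open>(R b, 0)\<close> has no functional part, so only the action of
    \<open>f\<close> survives next to the product.\<close>
  have left: "R (mult a (R b)) = mult (R a) (R b) - hit_left scale \<Delta> f (R b)"
    using R_mult_left[OF a(1-3), of "R b"] by (simp add: simps)
  have right: "R (mult (R a) b) = mult (R a) (R b) - hit_right scale \<Delta> (R a) g"
    using R_mult_right[OF b(1-3), of "R a"] by (simp add: simps)
  \<comment> \<open>\<open>w\<close> lies in \<open>J\<close> and is annihilated by
    \<open>I\<close>, so \<open>(b, 0)\<close> may be replaced by its \<open>I\<close>-component.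
    Both action terms then occur in \<open>R (mult a b)\<close>, with signs opposite to those in
    \<open>left\<close> and \<open>right\<close>.\<close>
  have "(- R a, f) \<odot> (b, 0) = (- R a, f) \<odot> (- R b, g)"
    using dmult_add(2)[OF ideal_carr[OF b(1)] swap.ideal_carr[OF b(2)] ideal_carr[OF a(1)]]
      ideals_mult[OF a(1) b(2)] b(3) by simp
  then have "R (mult a b) =
      - (mult (R a) (R b) - hit_left scale \<Delta> f (R b) - hit_right scale \<Delta> (R a) g)"
    using R_mult_left[OF a(1-3), of b] by (simp add: simps)
  \<comment> \<open>In the sum of the three values the action terms cancel, and of the products
    \<open>mult (R a) (R b)\<close> two enter positively and one negatively.\<close>
  with left right show ?thesis by (simp add: R_linear)
qed

end

theorem theorem1:
  fixes scale :: "'f::field_char_0 \<Rightarrow> 'a::ab_group_add \<Rightarrow> 'a"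
    and mult :: "'a \<Rightarrow> 'a \<Rightarrow> 'a"
    and \<Delta> :: "'a \<Rightarrow> (('a \<times> 'a) \<Rightarrow>\<^sub>0 'f) set"
    and A1 A2 :: "('a \<times> ('a \<Rightarrow> 'f)) set"
  assumes "fd_algebra scale mult"
    and "simple_algebra scale mult UNIV"
    and "comultiplication scale \<Delta>"
    and "is_ideal (double_scale scale) (double_mult scale mult \<Delta>) (double_carrier scale) A1"
    and "is_ideal (double_scale scale) (double_mult scale mult \<Delta>) (double_carrier scale) A2"
    and "simple_algebra (double_scale scale) (double_mult scale mult \<Delta>) A1"
    and "simple_algebra (double_scale scale) (double_mult scale mult \<Delta>) A2"
    and "is_direct_sum (double_carrier scale) A1 A2"
  shows "rota_baxter scale mult 1 (\<lambda>a. phi A1 (psi scale A1 A2 a))"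
proof -
  interpret fd_algebra scale mult by fact
  interpret decomposed_double scale mult \<Delta> A1 A2
    by unfold_locales (use assms in auto)
  have "Vector_Spaces.linear scale scale R"
    by unfold_locales (simp_all add: R_linear)
  then show ?thesis
    unfolding rota_baxter_def R_def[symmetric] scale_one using R_rota_baxter by blast
qed

end
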